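(* For every infinite cardinal $\nu$ and every cardinal $\rho\ge\beth_\omega(\nu)$, for all but finitely many $n<\omega$ it holds that $$\mathcal D(\rho,\beth_n(\nu))=\rho,$$ and $$\mathcal D(\rho,\nu,\beth_\omega(\nu))=\rho.$$
   Context: Work in ZFC. $\beth_0(\nu)=\nu$, $\beth_{n+1}(\nu)=2^{\beth_n(\nu)}$, $\beth_\omega(\nu)=\sup_{n<\omega}\beth_n(\nu)$. $[X]^\kappa$ is the collection of subsets of $X$ of cardinality $\kappa$. For cardinals $\kappa_1\le\kappa_2\le\lambda$, a set $\mathcal D\subseteq[\lambda]^{\kappa_1}$ is dense in $[\lambda]^{\kappa_2}$ if for every $X\in[\lambda]^{\kappa_2}$ there is $Y\in\mathcal D$ with $Y\subseteq X$. The density $\mathcal D(\lambda,\kappa_1,\kappa_2)$ is the least cardinality of a set $\mathcal D\subseteq[\lambda]^{\kappa_1}$ which is dense in $[\lambda]^{\kappa_2}$, and $\mathcal D(\lambda,\kappa):=\mathcal D(\lambda,\kappa,\kappa)$ for $\kappa\le\lambda$. *)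

theory Defs
  imports Main
begin

unbundle cardinal_syntax

text \<open>
  A cardinal is a relation \<open>r\<close> with \<^term>\<open>Card_order r\<close>; two such relations, possibly on
  different types, denote the same cardinal iff \<^term>\<open>r =o s\<close>. A cardinal \<open>r\<close>, viewed as a set,
  is \<^term>\<open>Field r\<close>.
\<close>

definition subsets_of_card :: "'a set \<Rightarrow> 'b rel \<Rightarrow> 'a set set" where
  "subsets_of_card X k = {Y. Y \<subseteq> X \<and> |Y| =o k}"

definition dense_in :: "'a set set \<Rightarrow> 'a set set \<Rightarrow> bool" where
  "dense_in D S \<longleftrightarrow> (\<forall>X\<in>S. \<exists>Y\<in>D. Y \<subseteq> X)"

definition dense_family :: "'a rel \<Rightarrow> 'b rel \<Rightarrow> 'c rel \<Rightarrow> 'a set set \<Rightarrow> bool" where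
  "dense_family l k1 k2 D \<longleftrightarrow>
     D \<subseteq> subsets_of_card (Field l) k1 \<and> dense_in D (subsets_of_card (Field l) k2)"

text \<open>The choice below picks a dense family of least cardinality; one exists whenever
  \<open>k1 \<le> k2\<close>, see \<open>density_least\<close>.\<close>

definition density :: "'a rel \<Rightarrow> 'b rel \<Rightarrow> 'c rel \<Rightarrow> 'a set rel" where
  "density l k1 k2 =
     |SOME D. dense_family l k1 k2 D \<and> (\<forall>E. dense_family l k1 k2 E \<longrightarrow> |D| \<le>o |E| )|"

abbreviation density_same :: "'a rel \<Rightarrow> 'b rel \<Rightarrow> 'a set rel" where
  "density_same l k \<equiv> density l k k"

lemma ex_dense_family:
  assumes "Card_order k1" "k1 \<le>o k2"
  shows "dense_family l k1 k2 (subsets_of_card (Field l) k1)"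
proof -
  have "\<exists>Y\<in>subsets_of_card (Field l) k1. Y \<subseteq> X" if "X \<in> subsets_of_card (Field l) k2" for X
  proof -
    from that have X: "X \<subseteq> Field l" "|X| =o k2" by (auto simp: subsets_of_card_def)
    have "|Field k1| =o k1" using assms(1) by (rule card_of_Field_ordIso)
    also note assms(2)
    also have "k2 =o |X|" using X(2) by (rule ordIso_symmetric)
    finally have "|Field k1| \<le>o |X|" .
    then obtain f where f: "inj_on f (Field k1)" "f ` Field k1 \<subseteq> X"
      by (auto simp: card_of_ordLeq[symmetric])
    have "|f ` Field k1| =o |Field k1|"
      using f(1) card_of_ordIso inj_on_imp_bij_betw ordIso_symmetric by blast
    then have "|f ` Field k1| =o k1"
      using card_of_Field_ordIso[OF assms(1)] ordIso_transitive by blast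
    with f(2) X(1) show ?thesis by (auto simp: subsets_of_card_def)
  qed
  then show ?thesis by (auto simp: dense_family_def dense_in_def)
qed

lemma density_least:
  assumes "Card_order k1" "k1 \<le>o k2"
  shows "\<exists>D. dense_family l k1 k2 D \<and> density l k1 k2 = |D|"
    and "dense_family l k1 k2 E \<Longrightarrow> density l k1 k2 \<le>o |E|"
proof -
  let ?P = "\<lambda>D. dense_family l k1 k2 D \<and> (\<forall>E. dense_family l k1 k2 E \<longrightarrow> |D| \<le>o |E| )"
  let ?R = "card_of ` {D. dense_family l k1 k2 D}"
  have "?R \<noteq> {}" using ex_dense_family[OF assms] by blast
  moreover have "\<forall>r\<in>?R. Card_order r" by (auto simp: card_of_Card_order)
  ultimately have "\<exists>r\<in>?R. \<forall>r'\<in>?R. r \<le>o r'" by (rule exists_minim_Card_order)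
  then have "\<exists>D. ?P D" by blast
  then have "?P (SOME D. ?P D)" by (rule someI_ex)
  then show "\<exists>D. dense_family l k1 k2 D \<and> density l k1 k2 = |D|"
    and "dense_family l k1 k2 E \<Longrightarrow> density l k1 k2 \<le>o |E|"
    unfolding density_def by blast+
qed

text \<open>
  No single HOL type provably contains all \<open>\<beth>\<^sub>n(\<nu>)\<close>, so the sequence of beth cardinals
  is specified by its recursion, which determines it up to \<open>=o\<close> (\<open>beth_seq_unique\<close>).
\<close>

definition beth_seq :: "'b rel \<Rightarrow> (nat \<Rightarrow> 'c rel) \<Rightarrow> bool" where
  "beth_seq \<nu> b \<longleftrightarrow> (\<forall>n. Card_order (b n)) \<and> b 0 =o \<nu> \<and> (\<forall>n. b (Suc n) =o ctwo ^c b n)"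

lemma beth_seq_unique:
  assumes "beth_seq \<nu> b" "beth_seq \<nu> c"
  shows "b n =o c n"
proof (induction n)
  case 0
  then show ?case
    using assms ordIso_symmetric ordIso_transitive unfolding beth_seq_def by blast
next
  case (Suc n)
  have "ctwo ^c b n =o ctwo ^c c n"
    using assms Suc by (intro cexp_cong2) (auto simp: beth_seq_def Card_order_ctwo)
  then show ?case
    using assms ordIso_symmetric ordIso_transitive unfolding beth_seq_def by meson
qed

text \<open>Leastness is only required within the type of \<open>s\<close>; by \<open>card_sup_least\<close> it then
  holds for upper bounds on every type.\<close>

definition card_sup :: "(nat \<Rightarrow> 'c rel) \<Rightarrow> 'd rel \<Rightarrow> bool" where
  "card_sup b s \<longleftrightarrow> Card_order s \<and> (\<forall>n. b n \<le>o s) \<and>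
     (\<forall>t::'d rel. Card_order t \<and> (\<forall>n. b n \<le>o t) \<longrightarrow> s \<le>o t)"

lemma card_sup_least:
  assumes s: "card_sup b s" and t: "Card_order t" "\<And>n. b n \<le>o t"
  shows "s \<le>o t"
proof (rule ccontr)
  assume n: "\<not> s \<le>o t"
  have cs: "Card_order s" using s by (simp add: card_sup_def)
  from n have lt: "t <o s"
    using cs t(1) not_ordLeq_iff_ordLess unfolding card_order_on_def by blast
  then have "|Field t| \<le>o |Field s|"
    using card_of_mono2 ordLess_imp_ordLeq by blast
  then obtain f where f: "inj_on f (Field t)" "f ` Field t \<subseteq> Field s"
    by (auto simp: card_of_ordLeq[symmetric])
  have "|f ` Field t| =o |Field t|"
    using f(1) card_of_ordIso inj_on_imp_bij_betw ordIso_symmetric by blast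
  then have eq: "|f ` Field t| =o t"
    using card_of_Field_ordIso[OF t(1)] ordIso_transitive by blast
  have "\<forall>n. b n \<le>o |f ` Field t|"
    using t(2) ordIso_symmetric[OF eq] ordLeq_ordIso_trans by blast
  then have "s \<le>o |f ` Field t|"
    using s card_of_Card_order unfolding card_sup_def by blast
  then show False using eq n ordLeq_ordIso_trans by blast
qed


end

theory Submission
  imports Defs
begin

text \<open>
  The theorem follows from a form of Shelah's revised GCH: for every \<open>L\<close> there is \<open>n\<close> such that
  for every \<open>k\<close> some \<open>|L|\<close> functions \<open>\<beth>\<^sub>k \<rightarrow> L\<close> suffice to cover every such function by
  \<open>\<beth>\<^sub>n\<close> pieces. By Koenig's theorem one piece of an injective function on \<open>\<beth>\<^sub>m\<close>, \<open>m > n\<close>, has full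
  size, so the images of the \<open>|L|\<close> functions yield a dense family.

  Let \<open>|L| = r\<close> be a minimal counterexample. Then for every \<open>n\<close> there is a \<open>\<beth>\<^sub>n\<close>-complete ideal on some
  \<open>\<beth>\<^sub>k\<close> with more than \<open>r\<close> functions into \<open>r\<close> that are pairwise different modulo it. Fix such an
  ideal \<open>N\<close> on \<open>I\<close> for \<open>n = 0\<close>, and \<open>f : I \<rightarrow> r\<close> minimal modulo \<open>N\<close> with \<open>r\<close> different
  functions below it. The values of \<open>f\<close> are smaller than \<open>r\<close> and so satisfy the covering
  property; commuting \<open>N\<close> with a much more complete ideal on some \<open>J\<close> that carries more than \<open>r\<close>
  different functions produces more than \<open>r\<close> different functions below \<open>f\<close>. One of these
  again has \<open>r\<close> different functions below it, contradicting the minimality of \<open>f\<close>.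
\<close>

section \<open>Functions modulo a complete ideal\<close>

lemma Card_order_ordLess_iff: "Card_order r \<Longrightarrow> r <o |X| \<longleftrightarrow> \<not> |X| \<le>o r"
  by (rule not_ordLeq_iff_ordLess[symmetric]) (auto simp: card_order_on_def card_of_Well_order)

lemma Cinfinite_card_of: "infinite A \<Longrightarrow> Cinfinite |A|"
  by (simp add: cinfinite_def Field_card_of card_of_card_order_on)

lemma Field_cardSuc_ordLeq:
  assumes "Card_order r" "\<not> |X| \<le>o r"
  shows "|Field (cardSuc r)| \<le>o |X|"
proof -
  have "cardSuc r \<le>o |X|"
    using cardSuc_ordLess_ordLeq[OF assms(1) card_of_Card_order, of X]
      Card_order_ordLess_iff[OF assms(1), of X] assms(2) by simp
  with card_of_Field_ordIso[OF cardSuc_Card_order[OF assms(1)]] show ?thesis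
    by (rule ordIso_ordLeq_trans)
qed

lemma ordLeq_card_of_inj:
  assumes "r \<le>o |X|"
  obtains f where "inj_on f (Field r)" "f ` Field r \<subseteq> X"
proof -
  from card_of_mono2[OF assms] have "|Field r| \<le>o |X|" by (simp add: Field_card_of)
  with that show ?thesis by (auto simp: card_of_ordLeq[symmetric])
qed

text \<open>Otherwise \<open>X\<close> is a union of at most \<open>r\<close> fibres of size at most
  \<open>r\<close>. As \<open>X\<close> is strictly larger than \<open>r\<close>, this works for
  singular \<open>r\<close> as well.\<close>

lemma pigeonhole_ordLeq:
  assumes "Cinfinite r" "f ` X \<subseteq> Y" "|Y| \<le>o r" "\<not> |X| \<le>o r"
  obtains y where "y \<in> Y" "\<not> |{x \<in> X. f x = y}| \<le>o r"
proof -
  have "X = (\<Union>y\<in>Y. {x \<in> X. f x = y})" using assms(2) by auto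
  with that UNION_Cinfinite_bound[OF assms(3), of "\<lambda>y. {x \<in> X. f x = y}"] assms(1,4)
  show ?thesis by metis
qed

text \<open>A proper \<tau>^+-complete ideal: unions of \<tau> many members are included. The case
  \<open>C = {}\<close> puts the empty set into \<open>E\<close>.\<close>

definition complete_ideal :: "'k rel \<Rightarrow> 'i set \<Rightarrow> 'i set set \<Rightarrow> bool" where
  "complete_ideal \<tau> J E \<longleftrightarrow>
     E \<subseteq> Pow J \<and> J \<notin> E \<and> (\<forall>B\<in>E. Pow B \<subseteq> E) \<and> (\<forall>C\<subseteq>E. |C| \<le>o \<tau> \<longrightarrow> \<Union>C \<in> E)"

text \<open>For positive \<open>A\<close> this is stronger than inequality modulo the ideal: the set
  of agreement must be null, not merely the set of disagreement positive.\<close>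

definition different_on :: "'i set set \<Rightarrow> 'i set \<Rightarrow> 'x set \<Rightarrow> ('x \<Rightarrow> 'i \<Rightarrow> 'a) \<Rightarrow> bool" where
  "different_on E A X h \<longleftrightarrow> (\<forall>x\<in>X. \<forall>y\<in>X. x \<noteq> y \<longrightarrow> {i \<in> A. h x i = h y i} \<in> E)"

text \<open>
  The covering form of Shelah's revised GCH; indexing the family \<open>e\<close> by \<open>L\<close> bounds its size by \<open>|L|\<close>.
\<close>

definition covered :: "'a set \<Rightarrow> 'i set \<Rightarrow> 'k rel \<Rightarrow> bool" where
  "covered L J \<tau> \<longleftrightarrow> (\<exists>e. \<forall>g. g ` J \<subseteq> L \<longrightarrow>
     (\<exists>Q\<subseteq>L. |Q| \<le>o \<tau> \<and> (\<forall>j\<in>J. \<exists>q\<in>Q. e q j = g j)))"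

lemma complete_ideal_subset: "complete_ideal \<tau> J E \<Longrightarrow> B \<in> E \<Longrightarrow> C \<subseteq> B \<Longrightarrow> C \<in> E"
  unfolding complete_ideal_def by blast

lemma complete_ideal_UN:
  assumes "complete_ideal \<tau> J E" "|K| \<le>o \<tau>" "\<And>k. k \<in> K \<Longrightarrow> B k \<in> E"
  shows "(\<Union>k\<in>K. B k) \<in> E"
proof -
  have "|B ` K| \<le>o \<tau>" using card_of_image assms(2) by (rule ordLeq_transitive)
  moreover have "B ` K \<subseteq> E" using assms(3) by blast
  ultimately show ?thesis using assms(1) unfolding complete_ideal_def by blast
qed

lemma complete_ideal_UN_nat:
  assumes "complete_ideal \<tau> J E" "Cinfinite \<tau>" "\<And>n::nat. B n \<in> E"
  shows "(\<Union>n. B n) \<in> E"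
proof -
  have "|UNIV::nat set| \<le>o \<tau>"
    using natLeq_ordLeq_cinfinite[OF assms(2)] card_of_nat ordIso_ordLeq_trans by blast
  then show ?thesis by (rule complete_ideal_UN[OF assms(1) _ assms(3)])
qed

text \<open>Zorn's lemma. By maximality a function outside \<open>M\<close> agrees with some member
  on a positive set; a member of \<open>M\<close> agrees with itself on all of
  \<open>A\<close>.\<close>

lemma maximal_different:
  assumes "A \<notin> E"
  obtains M where "M \<subseteq> S" "different_on E A M (\<lambda>g. g)"
    "\<And>g. g \<in> S \<Longrightarrow> \<exists>q\<in>M. {i \<in> A. g i = q i} \<notin> E"
proof -
  let ?F = "{M. M \<subseteq> S \<and> different_on E A M (\<lambda>g. g)}"
  have "\<exists>M\<in>?F. \<forall>X\<in>?F. M \<subseteq> X \<longrightarrow> X = M"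
  proof (rule subset_Zorn')
    fix C assume C: "subset.chain ?F C"
    then have ch: "C \<subseteq> ?F" "\<And>X Y. X \<in> C \<Longrightarrow> Y \<in> C \<Longrightarrow> X \<subseteq> Y \<or> Y \<subseteq> X"
      by (auto simp: subset_chain_def)
    have "{i \<in> A. g i = h i} \<in> E" if gh: "g \<in> \<Union>C" "h \<in> \<Union>C" "g \<noteq> h" for g h
    proof -
      from gh obtain X Y where "X \<in> C" "g \<in> X" "Y \<in> C" "h \<in> Y" by blast
      with ch(2) obtain Z where "Z \<in> C" "g \<in> Z" "h \<in> Z" by blast
      with ch(1) gh(3) show ?thesis unfolding different_on_def by blast
    qed
    with ch(1) show "\<Union>C \<in> ?F" unfolding different_on_def by blast
  qed
  then obtain M where M: "M \<in> ?F" "\<forall>X\<in>?F. M \<subseteq> X \<longrightarrow> X = M" by (rule bexE)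
  have "\<exists>q\<in>M. {i \<in> A. g i = q i} \<notin> E" if g: "g \<in> S" for g
  proof (rule ccontr)
    assume n: "\<not> ?thesis"
    have 1: "{i \<in> A. g i = q i} \<in> E" "{i \<in> A. q i = g i} \<in> E" if "q \<in> M" for q
    proof -
      show "{i \<in> A. g i = q i} \<in> E" using n that by blast
      then show "{i \<in> A. q i = g i} \<in> E" by (simp only: eq_commute[of "q _"])
    qed
    have "insert g M \<subseteq> S" using M(1) g by blast
    moreover have "different_on E A (insert g M) (\<lambda>g. g)"
      unfolding different_on_def
    proof (intro ballI impI)
      fix p q assume "p \<in> insert g M" "q \<in> insert g M" "p \<noteq> q"
      then show "{i \<in> A. p i = q i} \<in> E"
        using M(1) 1 unfolding different_on_def by blast
    qed
    ultimately have "insert g M \<in> ?F" by simp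
    then have "insert g M = M" using bspec[OF M(2)] subset_insertI[of M g] by simp
    then have "g \<in> M" by blast
    moreover have "{i \<in> A. g i = g i} \<notin> E" using assms by simp
    ultimately show False using n by blast
  qed
  with M(1) that show ?thesis by blast
qed

text \<open>
  If for every complete ideal a maximal family of different functions had size at most \<open>r\<close>, the
  union of these families would be a cover: were \<open>g\<close> not covered, the sets on which
  \<open>\<tau>\<close> members of the union cover \<open>g\<close> would form a complete ideal, contradicting the maximality of
  the family chosen for that ideal.
\<close>

lemma not_covered_ideal:
  fixes r :: "'a rel" and J :: "'i set"
  assumes \<tau>: "Cinfinite \<tau>" and r: "Cinfinite r" and PJ: "|Pow (Pow J)| \<le>o r"
    and nc: "\<not> covered (Field r) J \<tau>"
  shows "\<exists>E. \<exists>M :: ('i \<Rightarrow> 'a) set. complete_ideal \<tau> J E \<and> different_on E J M (\<lambda>g. g) \<and>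
    (\<forall>g\<in>M. g ` J \<subseteq> Field r) \<and> \<not> |M| \<le>o r"
proof (rule ccontr)
  assume neg: "\<not> ?thesis"
  let ?S = "{g :: 'i \<Rightarrow> 'a. g ` J \<subseteq> Field r}"
  let ?I = "{E. complete_ideal \<tau> J E}"
  let ?P = "\<lambda>E M. M \<subseteq> ?S \<and> |M| \<le>o r \<and> (\<forall>g\<in>?S. \<exists>q\<in>M. {j \<in> J. g j = q j} \<notin> E)"
  have "\<forall>E\<in>?I. \<exists>M. ?P E M"
  proof
    fix E assume E: "E \<in> ?I"
    from E have "J \<notin> E" by (simp add: complete_ideal_def)
    then obtain M where M: "M \<subseteq> ?S" "different_on E J M (\<lambda>g. g)"
      "\<And>g. g \<in> ?S \<Longrightarrow> \<exists>q\<in>M. {i \<in> J. g i = q i} \<notin> E"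
      by (rule maximal_different) blast
    have "|M| \<le>o r" using neg E M(1,2) by blast
    with M(1,3) have "?P E M" by simp
    then show "\<exists>M. ?P E M" by (rule exI)
  qed
  then have "\<exists>M. \<forall>E\<in>?I. ?P E (M E)" by (rule bchoice)
  then obtain M where M: "\<forall>E\<in>?I. ?P E (M E)" by (rule exE)
  \<comment> \<open>There are at most \<open>r\<close> such ideals, so the union of the chosen
    families can be indexed by \<open>Field r\<close>; \<open>e\<close> inverts this
    indexing.\<close>
  have "?I \<subseteq> Pow (Pow J)" by (auto simp: complete_ideal_def)
  then have "|?I| \<le>o r" by (rule ordLeq_transitive[OF card_of_mono1 PJ])
  then have "|\<Union>E\<in>?I. M E| \<le>o r" by (rule UNION_Cinfinite_bound) (use M r in auto)
  then have "|\<Union>E\<in>?I. M E| \<le>o |Field r|"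
    by (rule ordLeq_ordIso_trans) (use r card_of_Field_ordIso ordIso_symmetric in auto)
  then obtain c where c: "inj_on c (\<Union>E\<in>?I. M E)" "c ` (\<Union>E\<in>?I. M E) \<subseteq> Field r"
    by (auto simp: card_of_ordLeq[symmetric])
  define e where "e = inv_into (\<Union>E\<in>?I. M E) c"
  from nc obtain g where g: "g ` J \<subseteq> Field r"
    "\<And>Q. Q \<subseteq> Field r \<Longrightarrow> |Q| \<le>o \<tau> \<Longrightarrow> \<exists>j\<in>J. \<forall>q\<in>Q. e q j \<noteq> g j"
    unfolding covered_def by metis
  let ?cov = "\<lambda>B Q. Q \<subseteq> Field r \<and> |Q| \<le>o \<tau> \<and> (\<forall>j\<in>B. \<exists>q\<in>Q. e q j = g j)"
  define E where "E = {B. B \<subseteq> J \<and> (\<exists>Q. ?cov B Q)}"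
  have "\<Union>C \<in> E" if C: "C \<subseteq> E" "|C| \<le>o \<tau>" for C
  proof -
    from C(1) have "\<forall>B\<in>C. \<exists>Q. ?cov B Q" unfolding E_def by blast
    then have "\<exists>Q. \<forall>B\<in>C. ?cov B (Q B)" by (rule bchoice)
    then obtain Q where Q: "\<forall>B\<in>C. ?cov B (Q B)" by (rule exE)
    have "|\<Union>B\<in>C. Q B| \<le>o \<tau>"
    proof (rule UNION_Cinfinite_bound[OF C(2) _ \<tau>])
      show "\<forall>B\<in>C. |Q B| \<le>o \<tau>" using Q by simp
    qed
    moreover have "(\<Union>B\<in>C. Q B) \<subseteq> Field r" using Q by (intro UN_least) simp
    moreover have "\<exists>q\<in>(\<Union>B\<in>C. Q B). e q j = g j" if j: "j \<in> B" "B \<in> C" for j B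
    proof -
      obtain q where "q \<in> Q B" "e q j = g j" using bspec[OF Q j(2)] j(1) by auto
      then show ?thesis using j(2) by blast
    qed
    ultimately have "?cov (\<Union>C) (\<Union>B\<in>C. Q B)" by (intro conjI ballI) auto
    moreover have "\<Union>C \<subseteq> J" using C(1) unfolding E_def by blast
    ultimately show ?thesis unfolding E_def by (intro CollectI conjI exI[of _ "\<Union>B\<in>C. Q B"]) auto
  qed
  moreover have "J \<notin> E"
  proof
    assume "J \<in> E"
    then obtain Q where Q: "?cov J Q" unfolding E_def by auto
    then obtain j where "j \<in> J" "\<forall>q\<in>Q. e q j \<noteq> g j" using g(2)[of Q] by auto
    with Q show False by auto
  qed
  moreover have "C \<in> E" if "B \<in> E" "C \<subseteq> B" for B C
  proof -
    from that(1) obtain Q where "B \<subseteq> J" "?cov B Q" unfolding E_def by auto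
    with that(2) show ?thesis unfolding E_def by (intro CollectI conjI exI[of _ Q]) auto
  qed
  moreover have "E \<subseteq> Pow J" unfolding E_def by auto
  ultimately have "complete_ideal \<tau> J E" unfolding complete_ideal_def by (intro conjI ballI allI impI subsetI) auto
  then have E: "E \<in> ?I" by simp
  have "g \<in> ?S" using g(1) by simp
  \<comment> \<open>The family chosen for this \<open>E\<close> has a \<open>q\<close> agreeing with
    \<open>g\<close> on a positive set. But there the single index \<open>c q\<close> covers
    \<open>g\<close>, so the set belongs to \<open>E\<close>.\<close>
  with bspec[OF M E] have "\<exists>q\<in>M E. {j \<in> J. g j = q j} \<notin> E" by (elim conjE bspec)
  then obtain q where q: "q \<in> M E" "{j \<in> J. g j = q j} \<notin> E" by (rule bexE)
  have "e (c q) = q" using q(1) E c(1) unfolding e_def by (intro inv_into_f_f) auto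
  moreover have "c q \<in> Field r" using q(1) E c(2) by blast
  moreover have "Field \<tau> \<noteq> {}" using \<tau> by (auto simp: cinfinite_def)
  with \<tau> have "|{c q}| \<le>o \<tau>" by (simp add: Card_order_singl_ordLeq)
  ultimately have "?cov {j \<in> J. g j = q j} {c q}" by auto
  with q(2) show False unfolding E_def by blast
qed

section \<open>Families of different functions below a function\<close>

text \<open>
  For \<open>z\<close> the least element of \<open>r\<close>: adding it keeps the sets of admissible values
  nonempty, so that functions are unrestricted on null sets.
\<close>

definition many_below :: "'a rel \<Rightarrow> 'a \<Rightarrow> 'i set set \<Rightarrow> 'i set \<Rightarrow> ('i \<Rightarrow> 'a) \<Rightarrow> 'x set \<Rightarrow> bool" where
  "many_below r z N A f X \<longleftrightarrow>
     (\<exists>h. (\<forall>x\<in>X. \<forall>i\<in>A. h x i \<in> insert z (underS r (f i))) \<and> different_on N A X h)"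

lemma many_below_mono:
  assumes "many_below r z N A f X" "|Y| \<le>o |X|"
  shows "many_below r z N A f Y"
proof -
  from assms(2) obtain t where t: "inj_on t Y" "t ` Y \<subseteq> X"
    by (auto simp: card_of_ordLeq[symmetric])
  from assms(1) obtain h where "\<forall>x\<in>X. \<forall>i\<in>A. h x i \<in> insert z (underS r (f i))" "different_on N A X h"
    unfolding many_below_def by blast
  with t show ?thesis unfolding many_below_def different_on_def
    by (intro exI[of _ "h \<circ> t"]) (simp add: inj_on_eq_iff image_subset_iff)
qed

lemma many_below_null:
  assumes "complete_ideal \<tau> I N" "A \<in> N"
  shows "many_below r z N A f X"
  unfolding many_below_def different_on_def
  using assms by (intro exI[of _ "\<lambda>_ _. z"]) simp

text \<open>Two glued functions agree on a countable union of null sets.\<close>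

lemma many_below_glue:
  assumes N: "complete_ideal \<tau> I N" and \<tau>: "Cinfinite \<tau>"
    and b: "\<And>n::nat. many_below r z N {i \<in> I. c i = n} f X"
  shows "many_below r z N I f X"
proof -
  let ?P = "\<lambda>n h. (\<forall>x\<in>X. \<forall>i\<in>{i \<in> I. c i = n}. h x i \<in> insert z (underS r (f i))) \<and>
    different_on N {i \<in> I. c i = n} X h"
  have "\<forall>n. \<exists>h. ?P n h" using b unfolding many_below_def by blast
  then have "\<exists>h. \<forall>n. ?P n (h n)" by (rule choice)
  then obtain h where h: "\<forall>n. ?P n (h n)" by (rule exE)
  define H where "H x i = h (c i) x i" for x i
  have "{i \<in> I. H x i = H y i} \<in> N" if "x \<in> X" "y \<in> X" "x \<noteq> y" for x y
  proof -
    have "(\<Union>n. {i \<in> {i \<in> I. c i = n}. h n x i = h n y i}) \<in> N"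
    proof (rule complete_ideal_UN_nat[OF N \<tau>])
      show "{i \<in> {i \<in> I. c i = n}. h n x i = h n y i} \<in> N" for n
        using h that unfolding different_on_def by simp
    qed
    moreover have "(\<Union>n. {i \<in> {i \<in> I. c i = n}. h n x i = h n y i}) = {i \<in> I. H x i = H y i}"
      by (auto simp: H_def)
    ultimately show ?thesis by simp
  qed
  moreover have "\<forall>x\<in>X. \<forall>i\<in>I. H x i \<in> insert z (underS r (f i))"
    using h by (simp add: H_def)
  ultimately show ?thesis unfolding many_below_def different_on_def by blast
qed

lemma many_below_subset:
  assumes "complete_ideal \<tau> I N" "many_below r z N A f X" "B \<subseteq> A"
  shows "many_below r z N B f X"
proof -
  from assms(2) obtain h where h: "\<forall>x\<in>X. \<forall>i\<in>A. h x i \<in> insert z (underS r (f i))" "different_on N A X h"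
    unfolding many_below_def by blast
  have "{i \<in> B. h x i = h y i} \<in> N" if "x \<in> X" "y \<in> X" "x \<noteq> y" for x y
  proof (rule complete_ideal_subset[OF assms(1)])
    show "{i \<in> A. h x i = h y i} \<in> N" using h(2) that by (simp add: different_on_def)
  qed (use assms(3) in auto)
  then have "different_on N B X h" unfolding different_on_def by blast
  moreover have "\<forall>x\<in>X. \<forall>i\<in>B. h x i \<in> insert z (underS r (f i))" using h(1) assms(3) by blast
  ultimately show ?thesis unfolding many_below_def by blast
qed

text \<open>
  Composing \<open>r\<close> different functions below \<open>f\<close> with a function \<open>g : J \<rightarrow> r\<close> of \<open>M\<close> gives a matrix whose
  rows are covered. Since the ideal on \<open>J\<close> is so complete, all rows follow a single choice
  of covering functions on a common positive set of columns, and this choice is a function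
  below \<open>f\<close> which depends on \<open>g\<close>.
\<close>

lemma many_below_cardSuc:
  fixes r :: "'a rel" and J :: "'i set" and M :: "('i \<Rightarrow> 'a) set"
  assumes r: "Cinfinite r"
    and bg: "many_below r z N A f (Field r)"
    and cov: "\<And>i. i \<in> A \<Longrightarrow> covered (insert z (underS r (f i))) J \<tau>"
    and \<tau>: "Card_order \<tau>" and \<kappa>: "|Func A (Field \<tau>)| \<le>o \<kappa>"
    and E: "complete_ideal \<kappa> J E" and PJ: "|Pow J| \<le>o r"
    and M: "different_on E J M (\<lambda>g. g)" "\<And>g. g \<in> M \<Longrightarrow> g ` J \<subseteq> Field r" "\<not> |M| \<le>o r"
    and N: "complete_ideal \<tau>' I N"
  shows "many_below r z N A f (Field (cardSuc r))"
proof -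
  let ?L = "\<lambda>i. insert z (underS r (f i))"
  from bg obtain h where h: "\<And>x i. x \<in> Field r \<Longrightarrow> i \<in> A \<Longrightarrow> h x i \<in> ?L i"
    "different_on N A (Field r) h"
    unfolding many_below_def by blast
  from cov obtain e where e: "\<And>i g. i \<in> A \<Longrightarrow> g ` J \<subseteq> ?L i \<Longrightarrow>
      \<exists>Q\<subseteq>?L i. |Q| \<le>o \<tau> \<and> (\<forall>j\<in>J. \<exists>q\<in>Q. e i q j = g j)"
    unfolding covered_def by metis
  let ?P = "\<lambda>g B s. B \<subseteq> J \<and> B \<notin> E \<and> (\<forall>i\<in>A. s i \<in> ?L i \<and> (\<forall>j\<in>B. e i (s i) j = h (g j) i))"
  have "\<forall>g\<in>M. \<exists>B s. ?P g B s"
  proof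
    fix g assume g: "g \<in> M"
    have "\<exists>Q\<subseteq>?L i. |Q| \<le>o \<tau> \<and> (\<forall>j\<in>J. \<exists>q\<in>Q. e i q j = h (g j) i)" if i: "i \<in> A" for i
      using e[OF i, of "\<lambda>j. h (g j) i"] h(1) i M(2)[OF g] by (auto simp: image_subset_iff)
    then obtain Q where Q: "\<And>i. i \<in> A \<Longrightarrow> Q i \<subseteq> ?L i" "\<And>i. i \<in> A \<Longrightarrow> |Q i| \<le>o \<tau>"
      "\<And>i j. i \<in> A \<Longrightarrow> j \<in> J \<Longrightarrow> \<exists>q\<in>Q i. e i q j = h (g j) i"
      by metis
    from Q(3) obtain q where q: "\<And>i j. i \<in> A \<Longrightarrow> j \<in> J \<Longrightarrow> q i j \<in> Q i \<and> e i (q i j) j = h (g j) i"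
      by metis
    have "\<exists>u. inj_on u (Q i) \<and> u ` Q i \<subseteq> Field \<tau>" if "i \<in> A" for i
      using Q(2)[OF that] card_of_ordLeq card_of_mono2 Field_card_of by metis
    then obtain u where u: "\<And>i. i \<in> A \<Longrightarrow> inj_on (u i) (Q i) \<and> u i ` Q i \<subseteq> Field \<tau>" by metis
    \<comment> \<open>The choices made in column \<open>j\<close>, coded as a function into
      \<open>Field \<tau>\<close>. There are at most \<kappa> codes, so by completeness of
      \<open>E\<close> one code occurs on a positive set of columns.\<close>
    define v where "v j = (\<lambda>i. if i \<in> A then u i (q i j) else undefined)" for j
    have v: "v j \<in> Func A (Field \<tau>)" if "j \<in> J" for j
      using u q that unfolding v_def Func_def by (auto simp: image_subset_iff)
    have "\<exists>s\<in>Func A (Field \<tau>). {j \<in> J. v j = s} \<notin> E"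
    proof (rule ccontr)
      assume "\<not> ?thesis"
      then have "(\<Union>s\<in>Func A (Field \<tau>). {j \<in> J. v j = s}) \<in> E"
        by (intro complete_ideal_UN[OF E \<kappa>]) blast
      moreover have "(\<Union>s\<in>Func A (Field \<tau>). {j \<in> J. v j = s}) = J" using v by auto
      ultimately show False using E by (simp add: complete_ideal_def)
    qed
    then obtain s where s: "{j \<in> J. v j = s} \<notin> E" by blast
    have "{} \<in> E" using complete_ideal_UN[OF E, of "{}"] \<kappa> card_of_empty ordLeq_transitive by auto
    with s have "{j \<in> J. v j = s} \<noteq> {}" by metis
    then obtain j0 where j0: "j0 \<in> J" "v j0 = s" by blast
    have "q i j = q i j0" if "i \<in> A" "j \<in> J" "v j = s" for i j
    proof -
      have "u i (q i j) = u i (q i j0)"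
        using fun_cong[OF trans[OF that(3) j0(2)[symmetric]], of i] that(1) by (simp add: v_def)
      then show ?thesis using u q that j0(1) inj_on_eq_iff by metis
    qed
    then have 1: "e i (q i j0) j = h (g j) i" if "i \<in> A" "j \<in> {j \<in> J. v j = s}" for i j
      using q[of i j] that by simp
    have 2: "q i j0 \<in> ?L i" if "i \<in> A" for i using q j0(1) Q(1) that by blast
    have "?P g {j \<in> J. v j = s} (\<lambda>i. q i j0)" by (intro conjI ballI s 1 2) auto
    then show "\<exists>B s. ?P g B s" by (intro exI)
  qed
  then have "\<exists>B. \<forall>g\<in>M. \<exists>s. ?P g (B g) s" by (rule bchoice)
  then obtain B where "\<forall>g\<in>M. \<exists>s. ?P g (B g) s" by (rule exE)
  then have "\<exists>s. \<forall>g\<in>M. ?P g (B g) (s g)" by (rule bchoice)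
  then obtain s where Bs: "\<forall>g\<in>M. ?P g (B g) (s g)" by (rule exE)
  then have B: "\<And>g. g \<in> M \<Longrightarrow> B g \<subseteq> J" "\<And>g. g \<in> M \<Longrightarrow> B g \<notin> E"
    and s: "\<And>g i. g \<in> M \<Longrightarrow> i \<in> A \<Longrightarrow> s g i \<in> ?L i"
      "\<And>g i j. g \<in> M \<Longrightarrow> i \<in> A \<Longrightarrow> j \<in> B g \<Longrightarrow> e i (s g i) j = h (g j) i"
    by simp_all
  have "B ` M \<subseteq> Pow J" using B(1) by blast
  then obtain C where C: "\<not> |{g \<in> M. B g = C}| \<le>o r"
    by (rule pigeonhole_ordLeq[OF r _ PJ M(3)])
  let ?X = "{g \<in> M. B g = C}"
  have "{i \<in> A. s g i = s g' i} \<in> N" if gg: "g \<in> ?X" "g' \<in> ?X" "g \<noteq> g'" for g g'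
  proof -
    have "{j \<in> J. g j = g' j} \<in> E" using M(1) gg unfolding different_on_def by blast
    \<comment> \<open>The positive set \<open>C\<close> contains a \<open>j\<close> with
      \<open>g j \<noteq> g' j\<close>. In column \<open>j\<close> the value \<open>s g i\<close>
      determines \<open>h (g j) i\<close>, so \<open>s g\<close> and \<open>s g'\<close> agree only
      where two different members of \<open>h\<close> do.\<close>
    then have "\<not> C \<subseteq> {j \<in> J. g j = g' j}" using gg(1) B(2) complete_ideal_subset[OF E, of "{j \<in> J. g j = g' j}" C] by blast
    then obtain j where j: "j \<in> C" "j \<in> J" "g j \<noteq> g' j" using gg(1) B(1) by blast
    then have "g j \<in> Field r" "g' j \<in> Field r" using gg M(2) by blast+
    then have "{i \<in> A. h (g j) i = h (g' j) i} \<in> N" using h(2) j(3) unfolding different_on_def by blast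
    moreover have "{i \<in> A. s g i = s g' i} \<subseteq> {i \<in> A. h (g j) i = h (g' j) i}"
    proof
      fix i assume i: "i \<in> {i \<in> A. s g i = s g' i}"
      then have "e i (s g i) j = h (g j) i" "e i (s g' i) j = h (g' j) i"
        using s(2) gg j(1) by blast+
      with i show "i \<in> {i \<in> A. h (g j) i = h (g' j) i}" by simp
    qed
    ultimately show ?thesis by (rule complete_ideal_subset[OF N])
  qed
  then have "different_on N A ?X s" unfolding different_on_def by blast
  then have "many_below r z N A f ?X"
    using s(1) unfolding many_below_def by blast
  then show ?thesis by (rule many_below_mono[OF _ Field_cardSuc_ordLeq]) (use r C in simp_all)
qed

text \<open>A maximal family \<open>M\<close> of different functions below \<open>f\<close> has
  fewer than \<open>r\<close> members. Mapping a function to a member of \<open>M\<close> and the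
  positive set on which they agree is injective on any different family, which bounds all of them by
  |M| times 2^|I|. Writing the bound as an initial segment of \<open>r\<close> makes it an element
  of \<open>Field r\<close>, ready for a pigeonhole argument.\<close>

lemma not_many_below_bound:
  fixes I :: "'i set"
  assumes r: "Cinfinite r" and N: "complete_ideal \<tau> I N"
    and I: "infinite I" "|Pow I| <o r"
    and nb: "\<not> many_below r z N I f (Field r)"
  shows "\<exists>a\<in>Field r. \<not> many_below r z N I f (Field (cardSuc |underS r a| ))"
proof -
  have IN: "I \<notin> N" using N by (simp add: complete_ideal_def)
  let ?S = "{g. \<forall>i\<in>I. g i \<in> insert z (underS r (f i))}"
  obtain M where M: "M \<subseteq> ?S" "different_on N I M (\<lambda>g. g)"
    "\<And>g. g \<in> ?S \<Longrightarrow> \<exists>q\<in>M. {i \<in> I. g i = q i} \<notin> N"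
    using maximal_different[OF IN, of ?S] by blast
  have rF: "|Field r| =o r" using r card_of_Field_ordIso by blast
  have "many_below r z N I f M" unfolding many_below_def using M(1,2) by (intro exI[of _ "\<lambda>g. g"]) auto
  then have "\<not> |Field r| \<le>o |M|" using nb by (auto dest: many_below_mono)
  then have "|M| <o r"
    using rF Card_order_ordLess_iff[OF card_of_Card_order] ordLess_ordIso_trans by blast
  then have "|M <+> Pow I| <o r"
    using card_of_Plus_ordLess_infinite_Field I(2) r unfolding cinfinite_def by blast
  then obtain a where a: "a \<in> Field r" "|M <+> Pow I| =o Restr r (underS r a)"
    using r ordLess_iff_ordIso_Restr card_of_Well_order unfolding card_order_on_def by metis
  have "Field (Restr r (underS r a)) = underS r a"
  proof (rule Refl_Field_Restr2)
    show "Refl r" using r by (simp add: card_order_on_def well_order_on_def linear_order_on_def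
          partial_order_on_def preorder_on_def)
  qed (auto simp: underS_def Field_def)
  with card_of_cong[OF a(2)] have K: "|M <+> Pow I| =o |underS r a|" by (simp add: Field_card_of)
  have Kinf: "Cinfinite |M <+> Pow I|" using I(1) by (intro Cinfinite_card_of) simp
  let ?X = "Field (cardSuc |underS r a| )"
  have "\<not> many_below r z N I f ?X"
  proof
    assume "many_below r z N I f ?X"
    then obtain h where h: "\<And>x. x \<in> ?X \<Longrightarrow> h x \<in> ?S" "different_on N I ?X h"
      unfolding many_below_def by blast
    have "\<forall>x\<in>?X. \<exists>q. q \<in> M \<and> {i \<in> I. h x i = q i} \<notin> N" using M(3)[OF h(1)] by blast
    then have "\<exists>q. \<forall>x\<in>?X. q x \<in> M \<and> {i \<in> I. h x i = q x i} \<notin> N" by (rule bchoice)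
    then obtain q where q: "\<forall>x\<in>?X. q x \<in> M \<and> {i \<in> I. h x i = q x i} \<notin> N" by (rule exE)
    let ?t = "\<lambda>x. (q x, {i \<in> I. h x i = q x i})"
    have "inj_on ?t ?X"
    proof (rule inj_onI, rule ccontr)
      fix x y assume xy: "x \<in> ?X" "y \<in> ?X" "?t x = ?t y" "x \<noteq> y"
      then have "{i \<in> I. h x i = h y i} \<in> N" using h(2) unfolding different_on_def by simp
      moreover have "{i \<in> I. h x i = q x i} \<subseteq> {i \<in> I. h x i = h y i}"
      proof
        fix i assume i: "i \<in> {i \<in> I. h x i = q x i}"
        note qq = xy(3)[unfolded prod.inject, THEN conjunct1] xy(3)[unfolded prod.inject, THEN conjunct2]
        from i have "i \<in> {i \<in> I. h y i = q y i}" by (simp only: qq(2))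
        with i qq(1) show "i \<in> {i \<in> I. h x i = h y i}" by auto
      qed
      ultimately show False using bspec[OF q xy(1)] complete_ideal_subset[OF N] by blast
    qed
    moreover have "?t ` ?X \<subseteq> M \<times> Pow I" using q by auto
    ultimately have "|?X| \<le>o |M \<times> Pow I|" using card_of_ordLeq by blast
    also have "|M \<times> Pow I| \<le>o |M <+> Pow I|"
      by (rule card_of_Times_ordLeq_infinite_Field)
        (use Kinf in \<open>simp_all add: cinfinite_def card_of_Plus1 card_of_Plus2\<close>)
    also note K
    finally have "|?X| \<le>o |underS r a|" .
    moreover have "|?X| =o cardSuc |underS r a|"
      by (rule card_of_Field_ordIso[OF cardSuc_Card_order[OF card_of_Card_order]])
    ultimately show False
      using cardSuc_greater[OF card_of_Card_order] not_ordLess_ordLeq ordIso_ordLeq_trans ordIso_symmetric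
      by blast
  qed
  with a(1) show ?thesis by blast
qed

text \<open>
  If the ideal were prime, the ultrapower would be linearly ordered and the claim would be
  immediate. In general, failure gives a large subfamily with a common bound and a
  common collection \<open>\<Z>\<close> of sets on which many functions lie below; for most pairs both
  sets where one function is below the other are in \<open>\<Z>\<close>, and gluing contradicts the bound.
\<close>

lemma exists_many_below:
  fixes p :: "'x \<Rightarrow> 'i \<Rightarrow> 'a"
  assumes r: "Cinfinite r" and \<tau>: "Cinfinite \<tau>" and N: "complete_ideal \<tau> I N"
    and I: "infinite I" "|Pow I| <o r" "|Pow (Pow I)| \<le>o r"
    and p: "\<And>x i. x \<in> X \<Longrightarrow> i \<in> I \<Longrightarrow> p x i \<in> Field r" "different_on N I X p" "\<not> |X| \<le>o r"
  shows "\<exists>x\<in>X. many_below r z N I (p x) (Field r)"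
proof (rule ccontr)
  assume neg: "\<not> ?thesis"
  have rF: "|Field r| =o r" using r card_of_Field_ordIso by blast
  have "\<forall>x\<in>X. \<exists>a\<in>Field r. \<not> many_below r z N I (p x) (Field (cardSuc |underS r a| ))"
    using neg not_many_below_bound[OF r N I(1,2)] by blast
  then have "\<forall>x\<in>X. \<exists>a. a \<in> Field r \<and> \<not> many_below r z N I (p x) (Field (cardSuc |underS r a| ))" by blast
  then have "\<exists>\<alpha>. \<forall>x\<in>X. \<alpha> x \<in> Field r \<and> \<not> many_below r z N I (p x) (Field (cardSuc |underS r (\<alpha> x)| ))"
    by (rule bchoice)
  then obtain \<alpha> where \<alpha>: "\<forall>x\<in>X. \<alpha> x \<in> Field r \<and> \<not> many_below r z N I (p x) (Field (cardSuc |underS r (\<alpha> x)| ))"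
    by (rule exE)
  then have "\<alpha> ` X \<subseteq> Field r" by blast
  moreover have "|Field r| \<le>o r" using rF by (simp add: ordIso_iff_ordLeq)
  ultimately obtain a where a: "a \<in> Field r" "\<not> |{x \<in> X. \<alpha> x = a}| \<le>o r"
    using p(3) by (rule pigeonhole_ordLeq[OF r])
  define Y where "Y = Field (cardSuc |underS r a| )"
  define \<J> where "\<J> x = {A \<in> Pow I. many_below r z N A (p x) Y}" for x
  have "\<J> ` {x \<in> X. \<alpha> x = a} \<subseteq> Pow (Pow I)" by (auto simp: \<J>_def)
  then obtain \<Z> where "\<not> |{x \<in> {x \<in> X. \<alpha> x = a}. \<J> x = \<Z>}| \<le>o r"
    by (rule pigeonhole_ordLeq[OF r _ I(3) a(2)])
  moreover define Z where "Z = {x \<in> {x \<in> X. \<alpha> x = a}. \<J> x = \<Z>}"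
  ultimately have Z: "\<not> |Z| \<le>o r" "Z \<subseteq> X" "\<And>x. x \<in> Z \<Longrightarrow> \<J> x = \<Z>"
    "\<And>x. x \<in> Z \<Longrightarrow> \<not> many_below r z N I (p x) Y"
    using \<alpha> by (auto simp: Y_def)
  define lt where "lt x y = {i \<in> I. p x i \<in> underS r (p y i)}" for x y
  define exc where "exc y = {x \<in> Z. lt x y \<notin> \<Z>}" for y
  define K where "K = Pow I <+> underS r a"
  have Kr: "|K| <o r"
    unfolding K_def
    by (rule card_of_Plus_ordLess_infinite_Field) (use I(2) card_of_underS a(1) r in \<open>auto simp: cinfinite_def\<close>)
  have K: "Cinfinite |K|" using I(1) unfolding K_def by (intro Cinfinite_card_of) simp
  \<comment> \<open>For each of the at most 2^|I| sets \<open>A\<close> outside \<open>\<Z>\<close>,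
    the \<open>x\<close> with \<open>lt x y = A\<close> give different functions below
    \<open>p y\<close> on \<open>A\<close>. More than \<open>|underS r a|\<close> of them would put
    \<open>A\<close> into \<open>\<J> y = \<Z>\<close>.\<close>
  have exc: "|exc y| \<le>o |K|" if y: "y \<in> Z" for y
  proof -
    have "|{x \<in> Z. lt x y = A}| \<le>o |K|" if A: "A \<in> Pow I - \<Z>" for A
    proof -
      let ?T = "{x \<in> Z. lt x y = A}"
      have "|?T| \<le>o |underS r a|"
      proof (rule ccontr)
        assume "\<not> ?thesis"
        then have "|Y| \<le>o |?T|" unfolding Y_def by (rule Field_cardSuc_ordLeq[OF card_of_Card_order])
        moreover have "many_below r z N A (p y) ?T"
        proof -
          have "{i \<in> A. p x i = p x' i} \<in> N" if "x \<in> ?T" "x' \<in> ?T" "x \<noteq> x'" for x x'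
          proof -
            have "{i \<in> I. p x i = p x' i} \<in> N" using that p(2) Z(2) unfolding different_on_def by auto
            then show ?thesis by (rule complete_ideal_subset[OF N]) (use A in auto)
          qed
          then have "different_on N A ?T p" unfolding different_on_def by blast
          then show ?thesis unfolding many_below_def
            by (intro exI[of _ p]) (auto simp: lt_def)
        qed
        ultimately have "many_below r z N A (p y) Y" by (rule many_below_mono[rotated])
        then have "A \<in> \<J> y" using A unfolding \<J>_def by blast
        then show False using Z(3) y A by blast
      qed
      then show ?thesis unfolding K_def by (rule ordLeq_transitive[OF _ card_of_Plus2])
    qed
    moreover have "|Pow I - \<Z>| \<le>o |K|"
      unfolding K_def by (rule ordLeq_transitive[OF card_of_mono1 card_of_Plus1]) blast
    ultimately have "|\<Union>A\<in>Pow I - \<Z>. {x \<in> Z. lt x y = A}| \<le>o |K|"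
      by (intro UNION_Cinfinite_bound[OF _ _ K] ballI)
    moreover have "exc y = (\<Union>A\<in>Pow I - \<Z>. {x \<in> Z. lt x y = A})"
    proof -
      have "lt x y \<in> Pow I" for x unfolding lt_def by blast
      then show ?thesis unfolding exc_def by blast
    qed
    ultimately show ?thesis by simp
  qed
  \<comment> \<open>Search for a pair with neither element exceptional for the other.
    \<open>H\<close> has size \<open>r\<close>, so \<open>H\<close> and its exceptional sets do not
    exhaust \<open>Z\<close>, which leaves an \<open>x\<close>; and \<open>exc x\<close> is too
    small to contain \<open>H\<close>, which leaves a \<open>y\<close>.\<close>
  have "r \<le>o |Z|" using Z(1) Card_order_ordLess_iff[of r Z] r by (simp add: ordLess_imp_ordLeq)
  then obtain f where f: "inj_on f (Field r)" "f ` Field r \<subseteq> Z"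
    by (rule ordLeq_card_of_inj)
  define H where "H = f ` Field r"
  have "|Field r| =o |H|" unfolding H_def using card_of_ordIsoI[OF inj_on_imp_bij_betw[OF f(1)]] .
  then have H: "|H| =o r" "H \<subseteq> Z"
    using rF f(2) unfolding H_def by (auto intro: ordIso_transitive ordIso_symmetric)
  have "|\<Union>y\<in>H. exc y| \<le>o r"
  proof (rule UNION_Cinfinite_bound)
    show "|H| \<le>o r" using H(1) ordIso_iff_ordLeq by blast
    show "\<forall>y\<in>H. |exc y| \<le>o r"
      using H(2) exc Kr ordLeq_ordLess_trans ordLess_imp_ordLeq by blast
  qed (rule r)
  then have "|H \<union> (\<Union>y\<in>H. exc y)| \<le>o r"
    using H(1) r by (intro Un_Cinfinite_bound) (auto simp: ordIso_iff_ordLeq)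
  then have "\<not> Z \<subseteq> H \<union> (\<Union>y\<in>H. exc y)" using Z(1) ordLeq_transitive[OF card_of_mono1] by blast
  then obtain x where x: "x \<in> Z" "x \<notin> H" "\<And>y. y \<in> H \<Longrightarrow> x \<notin> exc y" by blast
  have "\<not> H \<subseteq> exc x"
  proof
    assume "H \<subseteq> exc x"
    then have "|H| <o r"
      using ordLeq_ordLess_trans[OF ordLeq_transitive[OF card_of_mono1 exc[OF x(1)]] Kr] by blast
    then show False using H(1) not_ordLess_ordIso by blast
  qed
  then obtain y where y: "y \<in> H" "y \<notin> exc x" by blast
  then have yZ: "y \<in> Z" using H(2) by blast
  \<comment> \<open>As \<open>\<J>\<close> is constant on \<open>Z\<close>, both sets have many
    functions below the same \<open>p y\<close>, although on \<open>lt y x\<close> it is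
    \<open>p x\<close> that is larger.\<close>
  have "lt x y \<in> \<J> y" "lt y x \<in> \<J> y"
    using x y yZ Z(3) unfolding exc_def by blast+
  then have b: "many_below r z N (lt x y) (p y) Y" "many_below r z N (lt y x) (p y) Y" unfolding \<J>_def by auto
  \<comment> \<open>The third piece is where \<open>p x\<close> and \<open>p y\<close> agree, a null
    set.\<close>
  define c where "c i = (if i \<in> lt x y then 0 else if i \<in> lt y x then 1 else 2 :: nat)" for i
  have "many_below r z N {i \<in> I. c i = n} (p y) Y" for n
  proof -
    have "x \<noteq> y" using x(2) y(1) by blast
    then have e: "{i \<in> I. p x i = p y i} \<in> N"
      using p(2) x(1) yZ Z(2) unfolding different_on_def by auto
    have tri: "i \<in> lt x y \<or> i \<in> lt y x \<or> p x i = p y i" if "i \<in> I" for i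
    proof -
      have "p x i \<in> Field r" "p y i \<in> Field r" using p(1) x(1) yZ Z(2) that by blast+
      then show ?thesis using r that unfolding lt_def underS_def card_order_on_def well_order_on_def
          linear_order_on_def total_on_def by auto
    qed
    consider "n = 0" | "n = 1" | "n \<noteq> 0" "n \<noteq> 1" by blast
    then show ?thesis
    proof cases
      case 1
      then have "{i \<in> I. c i = n} \<subseteq> lt x y" by (auto simp: c_def split: if_splits)
      then show ?thesis by (rule many_below_subset[OF N b(1)])
    next
      case 2
      then have "{i \<in> I. c i = n} \<subseteq> lt y x" by (auto simp: c_def split: if_splits)
      then show ?thesis by (rule many_below_subset[OF N b(2)])
    next
      case 3
      then have "{i \<in> I. c i = n} \<subseteq> {i \<in> I. p x i = p y i}"
        using tri by (auto simp: c_def split: if_splits)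
      then show ?thesis by (rule many_below_null[OF N complete_ideal_subset[OF N e]])
    qed
  qed
  then have "many_below r z N I (p y) Y" by (rule many_below_glue[OF N \<tau>])
  then show False using Z(4) yZ by blast
qed

section \<open>Covering by beth numbers\<close>

lemma card_of_Pow_mono:
  assumes "|A| \<le>o |B|"
  shows "|Pow A| \<le>o |Pow B|"
proof -
  from assms obtain f where f: "inj_on f A" "f ` A \<subseteq> B" by (auto simp: card_of_ordLeq[symmetric])
  then have "inj_on ((`) f) (Pow A)" "(`) f ` Pow A \<subseteq> Pow B" by (auto simp: inj_on_image_Pow)
  then show ?thesis by (auto simp: card_of_ordLeq[symmetric])
qed

lemma card_of_Func_ordLeq_Pow:
  assumes \<kappa>: "Cinfinite \<kappa>" and "|A| \<le>o \<kappa>" "|B| \<le>o \<kappa>"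
  shows "|Func A B| \<le>o |Pow (Field \<kappa>)|"
proof -
  have "|A \<times> B| \<le>o \<kappa>"
    by (rule card_of_Times_ordLeq_infinite_Field) (use assms in \<open>simp_all add: cinfinite_def\<close>)
  then have "|A \<times> B| \<le>o |Field \<kappa>|" using card_of_mono2 by (fastforce simp: Field_card_of)
  then have "|Pow (A \<times> B)| \<le>o |Pow (Field \<kappa>)|" by (rule card_of_Pow_mono)
  moreover have "|Func A B| \<le>o |Pow (A \<times> B)|"
  proof -
    let ?G = "\<lambda>f. {(a, f a) |a. a \<in> A}"
    have "inj_on ?G (Func A B)"
    proof (rule inj_onI)
      fix f g assume fg: "f \<in> Func A B" "g \<in> Func A B" "?G f = ?G g"
      show "f = g"
      proof
        fix a show "f a = g a"
          using fg by (cases "a \<in> A") (auto simp: Func_def)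
      qed
    qed
    moreover have "?G ` Func A B \<subseteq> Pow (A \<times> B)" by (auto simp: Func_def)
    ultimately show ?thesis using card_of_ordLeq by blast
  qed
  ultimately show ?thesis by (rule ordLeq_transitive[rotated])
qed

text \<open>Otherwise \<open>F\<close> contains a sequence in which each term is below the previous
  one off a null set. By countable completeness some \<open>i\<close> avoids all these null sets,
  and the values at \<open>i\<close> descend forever in \<open>r\<close>.\<close>

lemma minimal_modulo_ideal:
  assumes r: "Well_order r" and \<tau>: "Cinfinite \<tau>" and N: "complete_ideal \<tau> I N" and F: "F \<noteq> {}"
  obtains f where "f \<in> F" "\<And>g. g \<in> F \<Longrightarrow> {i \<in> I. g i \<notin> underS r (f i)} \<notin> N"
proof (rule ccontr)
  assume "\<not> thesis"
  with that have "\<forall>f\<in>F. \<exists>g. g \<in> F \<and> {i \<in> I. g i \<notin> underS r (f i)} \<in> N" by blast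
  then have "\<exists>G. \<forall>f\<in>F. G f \<in> F \<and> {i \<in> I. G f i \<notin> underS r (f i)} \<in> N" by (rule bchoice)
  then obtain G where G: "\<forall>f\<in>F. G f \<in> F \<and> {i \<in> I. G f i \<notin> underS r (f i)} \<in> N" by (rule exE)
  from F obtain f0 where f0: "f0 \<in> F" by blast
  define s where "s n = (G ^^ n) f0" for n
  have sF: "s n \<in> F" for n by (induction n) (use f0 G in \<open>auto simp: s_def\<close>)
  have "(\<Union>n. {i \<in> I. s (Suc n) i \<notin> underS r (s n i)}) \<in> N"
  proof (rule complete_ideal_UN_nat[OF N \<tau>])
    show "{i \<in> I. s (Suc n) i \<notin> underS r (s n i)} \<in> N" for n
      using bspec[OF G sF[of n]] by (simp add: s_def)
  qed
  moreover have "I \<notin> N" using N by (simp add: complete_ideal_def)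
  ultimately have "\<not> I \<subseteq> (\<Union>n. {i \<in> I. s (Suc n) i \<notin> underS r (s n i)})"
    using complete_ideal_subset[OF N] by blast
  then obtain i where "\<And>n. s (Suc n) i \<in> underS r (s n i)" by blast
  then have "\<forall>n. (s (Suc n) i, s n i) \<in> r - Id" by (simp add: underS_def)
  then have "\<exists>g. \<forall>n. (g (Suc n), g n) \<in> r - Id" by (rule exI[of _ "\<lambda>n. s n i"])
  moreover have "wf (r - Id)" using r by (simp add: well_order_on_def)
  then have "\<not> (\<exists>g. \<forall>n. (g (Suc n), g n) \<in> r - Id)" by (rule wf_iff_no_infinite_down_chain[THEN iffD1])
  ultimately show False by (rule notE[rotated])
qed

lemma Well_order_least:
  assumes "Well_order r" "Field r \<noteq> {}"
  obtains z where "z \<in> Field r" "\<And>a. a \<in> Field r \<Longrightarrow> a \<noteq> z \<Longrightarrow> z \<in> underS r a" "underS r z = {}"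
proof -
  have wf: "wf (r - Id)" and tot: "Total r"
    using assms(1) by (simp_all add: well_order_on_def linear_order_on_def)
  from assms(2) obtain x where "x \<in> Field r" by blast
  from wfE_min[OF wf this] obtain z where z: "z \<in> Field r" "\<And>y. (y, z) \<in> r - Id \<Longrightarrow> y \<notin> Field r"
    by blast
  have "underS r z = {}" using z(2) by (auto simp: underS_def Field_def)
  moreover have "z \<in> underS r a" if "a \<in> Field r" "a \<noteq> z" for a
    using tot z that by (auto simp: total_on_def underS_def)
  ultimately show ?thesis using that z(1) by blast
qed

section \<open>The covering theorem along a beth sequence\<close>

context
  fixes b :: "nat \<Rightarrow> 'c rel"
  assumes inf: "\<And>n. Cinfinite (b n)" and pow: "\<And>n. |Pow (Field (b n))| =o b (Suc n)"
begin

lemma beth_Field: "|Field (b n)| =o b n"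
  using inf card_of_Field_ordIso by blast

lemma beth_less_Suc: "b n <o b (Suc n)"
  using ordIso_ordLess_trans[OF ordIso_symmetric[OF beth_Field] card_of_Pow] pow
  by (rule ordLess_ordIso_trans)

lemma beth_mono: "n \<le> m \<Longrightarrow> b n \<le>o b m"
proof (induction m rule: dec_induct)
  case base
  then show ?case using inf ordLeq_refl by blast
next
  case (step m)
  then show ?case using beth_less_Suc ordLess_imp_ordLeq ordLeq_transitive by blast
qed

lemma beth_Pow_Pow: "|Pow (Pow (Field (b n)))| \<le>o b (Suc (Suc n))"
proof -
  have "|Pow (Field (b n))| \<le>o |Field (b (Suc n))|"
    using ordIso_transitive[OF pow ordIso_symmetric[OF beth_Field]] by (simp add: ordIso_iff_ordLeq)
  then show ?thesis using card_of_Pow_mono pow ordLeq_ordIso_trans by blast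
qed

lemma beth_Func:
  assumes "A \<subseteq> Field (b k)" "k \<le> m" "n \<le> m"
  shows "|Func A (Field (b n))| \<le>o b (Suc m)"
proof -
  have "|Field (b j)| \<le>o b m" if "j \<le> m" for j
    using beth_Field beth_mono[OF that] by (rule ordIso_ordLeq_trans)
  then have "|Func A (Field (b n))| \<le>o |Pow (Field (b m))|"
    using assms ordLeq_transitive[OF card_of_mono1[OF assms(1)]] inf by (intro card_of_Func_ordLeq_Pow) auto
  then show ?thesis using pow by (rule ordLeq_ordIso_trans)
qed

lemma covered_beth:
  fixes L :: "'a set"
  shows "\<exists>n. \<forall>k. covered L (Field (b k)) (b n)"
proof (induction "|L|" arbitrary: L rule: wf_induct_rule[OF wf_ordLess])
  case (1 L)
  then have IH: "\<exists>n. \<forall>k. covered L' (Field (b k)) (b n)" if "|L'| <o |L|" for L' :: "'a set"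
    using that by blast
  show ?case
  proof (cases "\<exists>n. |L| \<le>o b n")
    case True
    then obtain n where n: "|L| \<le>o b n" by blast
    \<comment> \<open>Such a set covers itself: \<open>e q\<close> is the constant function
      \<open>q\<close>, and \<open>Q\<close> is all of \<open>L\<close>.\<close>
    have "covered L (Field (b k)) (b n)" for k
      unfolding covered_def using n by (intro exI[of _ "\<lambda>q _. q"] allI impI exI[of _ L]) auto
    then show ?thesis by blast
  next
    case False
    define r where "r = |L|"
    have rF: "Field r = L" by (simp add: r_def Field_card_of)
    have rC: "Card_order r" unfolding r_def by (rule card_of_Card_order)
    have br: "b n \<le>o r" "b n <o r" for n
    proof -
      show "b n <o r" using False Card_order_ordLess_iff[of "b n" L] inf unfolding r_def by blast
      then show "b n \<le>o r" by (rule ordLess_imp_ordLeq)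
    qed
    have r: "Cinfinite r" using cinfinite_mono[OF br(1)] inf rC by blast
    have rW: "Well_order r" using rC by (simp add: card_order_on_def)
    show ?thesis
    proof (rule ccontr)
      assume neg: "\<not> ?thesis"
      \<comment> \<open>The index \<open>k\<close> is not controlled by \<open>n\<close>, but
        \<open>r\<close> lies above every \<open>b k\<close>, so the double power set of the domain
        still has size at most \<open>r\<close>.\<close>
      have ideals: "\<exists>k E. \<exists>M :: ('c \<Rightarrow> 'a) set. complete_ideal (b n) (Field (b k)) E \<and>
          different_on E (Field (b k)) M (\<lambda>g. g) \<and> (\<forall>g\<in>M. g ` Field (b k) \<subseteq> Field r) \<and> \<not> |M| \<le>o r" for n
      proof -
        from neg obtain k where "\<not> covered (Field r) (Field (b k)) (b n)" unfolding rF by blast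
        moreover have "|Pow (Pow (Field (b k)))| \<le>o r"
          using beth_Pow_Pow br(1) by (rule ordLeq_transitive)
        ultimately show ?thesis using not_covered_ideal[OF inf r] by blast
      qed
      obtain k0 N and M0 :: "('c \<Rightarrow> 'a) set" where N: "complete_ideal (b 0) (Field (b k0)) N"
        and M0: "different_on N (Field (b k0)) M0 (\<lambda>g. g)"
          "\<forall>g\<in>M0. g ` Field (b k0) \<subseteq> Field r" "\<not> |M0| \<le>o r"
        using ideals[of 0] by (elim exE conjE)
      define I where "I = Field (b k0)"
      note N = N[folded I_def] and M0 = M0[folded I_def]
      have I: "infinite I" "|Pow I| <o r" "|Pow (Pow I)| \<le>o r"
      proof -
        show "infinite I" using inf unfolding I_def cinfinite_def by blast
        show "|Pow I| <o r" unfolding I_def using pow br(2) by (rule ordIso_ordLess_trans)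
        show "|Pow (Pow I)| \<le>o r" unfolding I_def using beth_Pow_Pow br(1) by (rule ordLeq_transitive)
      qed
      have "Field r \<noteq> {}" using r by (auto simp: cinfinite_def)
      with rW obtain z where z: "z \<in> Field r"
        "\<And>a. a \<in> Field r \<Longrightarrow> a \<noteq> z \<Longrightarrow> z \<in> underS r a" "underS r z = {}"
        by (rule Well_order_least) blast
      note exists_many_below = exists_many_below[OF r inf[of 0] N I, where z = z]
      define F where "F = {f. f ` I \<subseteq> Field r \<and> many_below r z N I f (Field r)}"
      have "\<exists>g\<in>M0. many_below r z N I g (Field r)"
      proof (rule exists_many_below)
        show "g i \<in> Field r" if "g \<in> M0" "i \<in> I" for g i using M0(2) that by blast
      qed (use M0 in auto)
      then have "F \<noteq> {}" using M0(2) unfolding F_def by blast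
      with rW inf[of 0] N obtain f where f: "f \<in> F"
        "\<And>g. g \<in> F \<Longrightarrow> {i \<in> I. g i \<notin> underS r (f i)} \<notin> N"
        by (rule minimal_modulo_ideal) blast
      then have fr: "\<And>i. i \<in> I \<Longrightarrow> f i \<in> Field r" and fbig: "many_below r z N I f (Field r)"
        unfolding F_def by auto
      have "\<forall>i\<in>I. \<exists>n. \<forall>k. covered (insert z (underS r (f i))) (Field (b k)) (b n)"
      proof
        fix i assume i: "i \<in> I"
        have "|{z} \<union> underS r (f i)| <o r"
        proof (rule Un_Cinfinite_bound_strict)
          have "|{z}| <o natLeq" by (simp add: finite_iff_ordLess_natLeq[symmetric])
          then show "|{z}| <o r" using natLeq_ordLeq_cinfinite[OF r] by (rule ordLess_ordLeq_trans)
        qed (use rC r fr[OF i] in \<open>simp_all add: card_of_underS\<close>)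
        then show "\<exists>n. \<forall>k. covered (insert z (underS r (f i))) (Field (b k)) (b n)"
          using IH[of "{z} \<union> underS r (f i)"] unfolding r_def by simp
      qed
      then have "\<exists>c. \<forall>i\<in>I. \<forall>k. covered (insert z (underS r (f i))) (Field (b k)) (b (c i))" by (rule bchoice)
      then obtain c where c: "\<forall>i\<in>I. \<forall>k. covered (insert z (underS r (f i))) (Field (b k)) (b (c i))"
        by (rule exE)
      \<comment> \<open>The level \<open>c i\<close> is a natural number, so \<open>I\<close> splits
        into countably many pieces of constant level, which can be treated separately and
        glued.\<close>
      have "many_below r z N I f (Field (cardSuc r))"
      proof (rule many_below_glue[OF N inf])
        fix n
        \<comment> \<open>Completeness \<open>b (Suc ?m)\<close> of the second ideal suffices for
          all functions from the piece, a subset of \<open>Field (b k0)\<close>, into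
          \<open>Field (b n)\<close>.\<close>
        let ?A = "{i \<in> I. c i = n}" and ?m = "max k0 n"
        obtain k E and M :: "('c \<Rightarrow> 'a) set" where E: "complete_ideal (b (Suc ?m)) (Field (b k)) E"
          and M: "different_on E (Field (b k)) M (\<lambda>g. g)"
            "\<forall>g\<in>M. g ` Field (b k) \<subseteq> Field r" "\<not> |M| \<le>o r"
          using ideals[of "Suc ?m"] by (elim exE conjE)
        show "many_below r z N ?A f (Field (cardSuc r))"
        proof (rule many_below_cardSuc[OF r _ _ _ _ E _ M(1) _ M(3) N])
          show "many_below r z N ?A f (Field r)" by (rule many_below_subset[OF N fbig]) blast
          show "covered (insert z (underS r (f i))) (Field (b k)) (b n)" if "i \<in> ?A" for i
            using c that by blast
          show "Card_order (b n)" using inf by blast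
          show "|Func ?A (Field (b n))| \<le>o b (Suc ?m)"
            by (rule beth_Func[of _ k0]) (auto simp: I_def)
          show "|Pow (Field (b k))| \<le>o r"
            using ordIso_ordLeq_trans[OF pow br(1)] .
          show "g ` Field (b k) \<subseteq> Field r" if "g \<in> M" for g using M(2) that by blast
        qed
      qed
      then obtain h where h: "\<And>x i. x \<in> Field (cardSuc r) \<Longrightarrow> i \<in> I \<Longrightarrow> h x i \<in> insert z (underS r (f i))"
        "different_on N I (Field (cardSuc r)) h"
        unfolding many_below_def by auto
      have hr: "h x i \<in> Field r" if "x \<in> Field (cardSuc r)" "i \<in> I" for x i
        using h(1)[OF that] z(1) by (auto simp: underS_def Field_def)
      have "\<exists>x\<in>Field (cardSuc r). many_below r z N I (h x) (Field r)"
      proof (rule exists_many_below[OF hr h(2)])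
        show "\<not> |Field (cardSuc r)| \<le>o r"
          using cardSuc_greater[OF rC] card_of_Field_ordIso[OF cardSuc_Card_order[OF rC]]
            not_ordLess_ordLeq ordIso_ordLeq_trans ordIso_symmetric by blast
      qed
      then obtain x where x: "x \<in> Field (cardSuc r)" "many_below r z N I (h x) (Field r)" by blast
      then have "h x \<in> F" using hr unfolding F_def by blast
      \<comment> \<open>Where \<open>f\<close> takes the least value, \<open>z\<close> is the only
        admissible value and all functions agree, so this set is null. Off it \<open>z\<close> is
        below \<open>f i\<close>, hence \<open>h x\<close> is strictly below
        \<open>f\<close>.\<close>
      moreover have "{i \<in> I. f i = z} \<in> N"
      proof -
        from fbig obtain h' where h': "\<forall>x\<in>Field r. \<forall>i\<in>I. h' x i \<in> insert z (underS r (f i))"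
          "different_on N I (Field r) h'"
          unfolding many_below_def by blast
        have "infinite (Field r - {z})" using r by (simp add: cinfinite_def)
        then obtain a where a: "a \<in> Field r" "a \<noteq> z" using infinite_imp_nonempty by blast
        then have "{i \<in> I. h' a i = h' z i} \<in> N" using h'(2) z(1) unfolding different_on_def by simp
        moreover have "{i \<in> I. f i = z} \<subseteq> {i \<in> I. h' a i = h' z i}"
        proof
          fix i assume i: "i \<in> {i \<in> I. f i = z}"
          then have "h' x i = z" if "x \<in> Field r" for x using h'(1) z(3) that by auto
          with i a(1) z(1) show "i \<in> {i \<in> I. h' a i = h' z i}" by simp
        qed
        ultimately show ?thesis by (rule complete_ideal_subset[OF N])
      qed
      moreover have "{i \<in> I. h x i \<notin> underS r (f i)} \<subseteq> {i \<in> I. f i = z}"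
        using h(1)[OF x(1)] z(2) fr by fastforce
      ultimately show False using f(2) complete_ideal_subset[OF N] by blast
    qed
  qed
qed

end

section \<open>Density\<close>

lemma subset_of_card:
  assumes "Card_order k" "k \<le>o |X|"
  obtains Y where "Y \<subseteq> X" "|Y| =o k"
proof -
  from assms(2) obtain f where f: "inj_on f (Field k)" "f ` Field k \<subseteq> X" by (rule ordLeq_card_of_inj)
  have "|f ` Field k| =o |Field k|"
    by (rule ordIso_symmetric[OF card_of_ordIsoI[OF inj_on_imp_bij_betw[OF f(1)]]])
  then have "|f ` Field k| =o k" using card_of_Field_ordIso[OF assms(1)] by (rule ordIso_transitive)
  with f(2) that show ?thesis by blast
qed

text \<open>Koenig's theorem: the cofinality of \<open>2\<^sup>\<kappa>\<close> exceeds \<open>\<kappa>\<close>.\<close>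

lemma Pow_cofinality:
  assumes K: "infinite K" and A: "|Pow K| \<le>o |A|" "A \<subseteq> (\<Union>q\<in>Q. B q)" and Q: "|Q| \<le>o |K|"
  shows "\<exists>q\<in>Q. |Pow K| \<le>o |B q|"
proof (rule ccontr)
  assume neg: "\<not> ?thesis"
  \<comment> \<open>A subset of \<open>K \<times> K\<close> acts as a \<open>K\<close>-indexed
    sequence of subsets of \<open>K\<close>, its sections.\<close>
  have "|Pow (K \<times> K)| \<le>o |A|"
    using card_of_Pow_mono[of "K \<times> K" K] card_of_Times_same_infinite[OF K] A(1)
    by (auto simp: ordIso_iff_ordLeq intro: ordLeq_transitive)
  then obtain \<theta> where \<theta>: "inj_on \<theta> (Pow (K \<times> K))" "\<theta> ` Pow (K \<times> K) \<subseteq> A"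
    by (auto simp: card_of_ordLeq[symmetric])
  from Q obtain u where u: "inj_on u Q" "u ` Q \<subseteq> K" by (auto simp: card_of_ordLeq[symmetric])
  \<comment> \<open>\<open>B q\<close> is too small for the sections at \<open>u q\<close> to
    exhaust \<open>Pow K\<close>; \<open>d q\<close> is a missed one.\<close>
  have "\<forall>q\<in>Q. \<exists>d. d \<in> Pow K \<and> (\<forall>G\<in>Pow (K \<times> K). \<theta> G \<in> B q \<longrightarrow> G `` {u q} \<noteq> d)"
  proof (rule ballI, rule ccontr)
    fix q assume q: "q \<in> Q" and n: "\<not> (\<exists>d. d \<in> Pow K \<and> (\<forall>G\<in>Pow (K \<times> K). \<theta> G \<in> B q \<longrightarrow> G `` {u q} \<noteq> d))"
    let ?C = "{G \<in> Pow (K \<times> K). \<theta> G \<in> B q}"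
    have "Pow K \<subseteq> (\<lambda>G. G `` {u q}) ` ?C"
    proof
      fix d assume "d \<in> Pow K"
      with n have "\<not> (\<forall>G\<in>Pow (K \<times> K). \<theta> G \<in> B q \<longrightarrow> G `` {u q} \<noteq> d)" by simp
      then obtain G where "G \<in> Pow (K \<times> K)" "\<theta> G \<in> B q" "G `` {u q} = d" by auto
      then show "d \<in> (\<lambda>G. G `` {u q}) ` ?C" by (intro image_eqI[of _ _ G]) simp_all
    qed
    then have "|Pow K| \<le>o |?C|" by (rule ordLeq_transitive[OF card_of_mono1 card_of_image])
    moreover have "|?C| \<le>o |B q|"
    proof -
      have "inj_on \<theta> ?C" by (rule inj_on_subset[OF \<theta>(1)]) blast
      moreover have "\<theta> ` ?C \<subseteq> B q" by blast
      ultimately show ?thesis using card_of_ordLeq by blast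
    qed
    ultimately have "|Pow K| \<le>o |B q|" by (rule ordLeq_transitive)
    with neg q show False by blast
  qed
  then have "\<exists>d. \<forall>q\<in>Q. d q \<in> Pow K \<and> (\<forall>G\<in>Pow (K \<times> K). \<theta> G \<in> B q \<longrightarrow> G `` {u q} \<noteq> d q)"
    by (rule bchoice)
  then obtain d where d: "\<forall>q\<in>Q. d q \<in> Pow K \<and> (\<forall>G\<in>Pow (K \<times> K). \<theta> G \<in> B q \<longrightarrow> G `` {u q} \<noteq> d q)"
    by (rule exE)
  \<comment> \<open>The diagonal set: its section at every \<open>u q\<close> is the missed one, so
    \<open>\<theta> G\<close> lies in no \<open>B q\<close>.\<close>
  define G where "G = {(u q, x) |q x. q \<in> Q \<and> x \<in> d q}"
  have G: "G \<in> Pow (K \<times> K)" using u(2) d unfolding G_def by fast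
  then have "\<theta> G \<in> A" using \<theta>(2) by blast
  then obtain q where q: "q \<in> Q" "\<theta> G \<in> B q" using A(2) by blast
  have "G `` {u q} = d q" using q(1) u(1) by (auto simp: G_def dest: inj_onD)
  then show False using d q G by blast
qed

text \<open>Fewer than \<open>l\<close> sets of size \<open>k1 <o l\<close> have a union of size at
  most max(|D|, k1), which is below \<open>l\<close> even for singular \<open>l\<close>. The
  complement then contains a set of size \<open>k2\<close> that includes no member of
  \<open>D\<close>.\<close>

lemma dense_family_large:
  fixes l :: "'a rel"
  assumes l: "Cinfinite l" and k1: "Cinfinite k1" "k1 <o l" and k2: "Card_order k2" "k2 \<le>o l"
    and D: "dense_family l k1 k2 D"
  shows "l \<le>o |D|"
proof (rule ccontr)
  assume "\<not> l \<le>o |D|"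
  then have Dl: "|D| <o l"
    using l not_ordLeq_iff_ordLess[of "|D|" l] by (auto simp: card_order_on_def card_of_Well_order)
  have k1F: "|Field k1| =o k1" using k1(1) card_of_Field_ordIso by blast
  let ?K = "D <+> Field k1"
  have Kl: "|?K| <o l"
    by (rule card_of_Plus_ordLess_infinite_Field)
      (use l Dl ordIso_ordLess_trans[OF k1F k1(2)] in \<open>simp_all add: cinfinite_def\<close>)
  have K: "Cinfinite |?K|" using k1(1) by (intro Cinfinite_card_of) (simp add: cinfinite_def)
  have "|\<Union>Y\<in>D. Y| \<le>o |?K|"
  proof (rule UNION_Cinfinite_bound[OF card_of_Plus1 _ K], rule ballI)
    fix Y assume "Y \<in> D"
    then have "|Y| =o k1" using D by (auto simp: dense_family_def subsets_of_card_def)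
    then have "|Y| =o |Field k1|" using ordIso_symmetric[OF k1F] by (rule ordIso_transitive)
    then show "|Y| \<le>o |?K|" using card_of_Plus2 by (rule ordIso_ordLeq_trans)
  qed
  then have U: "|\<Union>D| <o l" using ordLeq_ordLess_trans[OF _ Kl] by simp
  have "\<not> |Field l - \<Union>D| <o l"
  proof
    assume "|Field l - \<Union>D| <o l"
    then have "|(Field l - \<Union>D) \<union> \<Union>D| <o l" using U l by (rule Un_Cinfinite_bound_strict)
    moreover have "|Field l| \<le>o |(Field l - \<Union>D) \<union> \<Union>D|" by (rule card_of_mono1) blast
    ultimately have "|Field l| <o l" by (rule ordLeq_ordLess_trans[rotated])
    then show False using card_of_Field_ordIso l not_ordLess_ordIso by blast
  qed
  then have "l \<le>o |Field l - \<Union>D|"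
    using l not_ordLess_iff_ordLeq[of l "|Field l - \<Union>D|"] by (auto simp: card_order_on_def card_of_Well_order)
  with k2(2) have "k2 \<le>o |Field l - \<Union>D|" by (rule ordLeq_transitive)
  then obtain X where X: "X \<subseteq> Field l - \<Union>D" "|X| =o k2" by (rule subset_of_card[OF k2(1)])
  then have "X \<in> subsets_of_card (Field l) k2" by (auto simp: subsets_of_card_def)
  then obtain Y where Y: "Y \<in> D" "Y \<subseteq> X" using D by (auto simp: dense_family_def dense_in_def)
  with X(1) have "Y = {}" by blast
  moreover have "|Y| =o k1" using D Y(1) by (auto simp: dense_family_def subsets_of_card_def)
  ultimately have "|{} :: 'a set| =o k1" by simp
  then have "|{} :: 'a set| =o |Field k1|" using ordIso_symmetric[OF k1F] by (rule ordIso_transitive)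
  then show False using card_of_ordIso_finite[of "{} :: 'a set" "Field k1"] k1(1) by (simp add: cinfinite_def)
qed

lemma density_eqI:
  assumes l: "Cinfinite l" and k1: "Cinfinite k1" "k1 <o l" and k2: "Card_order k2" "k1 \<le>o k2" "k2 \<le>o l"
    and D: "dense_family l k1 k2 D" "|D| \<le>o l"
  shows "density l k1 k2 =o l"
proof -
  have k: "Card_order k1" using k1(1) by blast
  obtain E where E: "dense_family l k1 k2 E" "density l k1 k2 = |E|"
    using density_least(1)[OF k k2(2)] by blast
  have "density l k1 k2 \<le>o l"
    using density_least(2)[OF k k2(2) D(1)] D(2) by (rule ordLeq_transitive)
  moreover have "l \<le>o density l k1 k2"
    unfolding E(2) by (rule dense_family_large[OF l k1 k2(1,3) E(1)])
  ultimately show ?thesis by (simp add: ordIso_iff_ordLeq)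
qed

lemma covered_dense_family:
  fixes \<rho> :: "'a rel" and \<kappa> :: "'c rel" and \<mu> :: "'c rel"
  assumes \<rho>: "Cinfinite \<rho>" and \<kappa>: "Cinfinite \<kappa>" and \<mu>: "Card_order \<mu>" "|Pow (Field \<kappa>)| =o \<mu>"
    and \<tau>: "\<tau> \<le>o \<kappa>" and P: "|Pow (Field \<mu>)| \<le>o \<rho>"
    and cov: "covered (Field \<rho>) (Field \<mu>) \<tau>"
  shows "\<exists>D. dense_family \<rho> \<mu> \<mu> D \<and> |D| \<le>o \<rho>"
proof -
  let ?L = "Field \<rho>" and ?J = "Field \<mu>"
  from cov obtain e where e: "\<forall>g. g ` ?J \<subseteq> ?L \<longrightarrow> (\<exists>Q\<subseteq>?L. |Q| \<le>o \<tau> \<and> (\<forall>j\<in>?J. \<exists>q\<in>Q. e q j = g j))"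
    unfolding covered_def by blast
  define D where "D = {Y \<in> (\<lambda>(q, A). e q ` A) ` (?L \<times> Pow ?J). Y \<subseteq> ?L \<and> |Y| =o \<mu>}"
  have \<rho>F: "|?L| \<le>o \<rho>" using \<rho> card_of_Field_ordIso[of \<rho>] by (simp add: ordIso_iff_ordLeq)
  have "|?L \<times> Pow ?J| \<le>o \<rho>"
    by (rule card_of_Times_ordLeq_infinite_Field)
      (use \<rho> P \<rho>F in \<open>simp_all add: cinfinite_def\<close>)
  then have "|(\<lambda>(q, A). e q ` A) ` (?L \<times> Pow ?J)| \<le>o \<rho>" by (rule ordLeq_transitive[OF card_of_image])
  then have "|D| \<le>o \<rho>" by (rule ordLeq_transitive[rotated]) (auto simp: D_def intro: card_of_mono1)
  moreover have "dense_family \<rho> \<mu> \<mu> D"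
    unfolding dense_family_def dense_in_def
  proof (intro conjI ballI)
    show "D \<subseteq> subsets_of_card ?L \<mu>" by (auto simp: D_def subsets_of_card_def)
    fix X assume "X \<in> subsets_of_card ?L \<mu>"
    then have X: "X \<subseteq> ?L" "|X| =o \<mu>" by (auto simp: subsets_of_card_def)
    have "|?J| =o |X|" using card_of_Field_ordIso[OF \<mu>(1)] ordIso_symmetric[OF X(2)] by (rule ordIso_transitive)
    then obtain g where g: "bij_betw g ?J X" using card_of_ordIso by blast
    then have "g ` ?J = X" by (simp add: bij_betw_def)
    with X(1) have "\<exists>Q\<subseteq>?L. |Q| \<le>o \<tau> \<and> (\<forall>j\<in>?J. \<exists>q\<in>Q. e q j = g j)"
      by (intro e[rule_format]) simp
    then obtain Q where Q: "|Q| \<le>o \<tau>" "Q \<subseteq> ?L" "\<forall>j\<in>?J. \<exists>q\<in>Q. e q j = g j"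
      by (elim exE conjE)
    define A where "A q = {j \<in> ?J. e q j = g j}" for q
    have sub: "e q ` A q \<subseteq> X" for q using \<open>g ` ?J = X\<close> by (auto simp: A_def)
    have "\<exists>q\<in>Q. |Pow (Field \<kappa>)| \<le>o |e q ` A q|"
    proof (rule Pow_cofinality)
      show "infinite (Field \<kappa>)" using \<kappa> by (simp add: cinfinite_def)
      show "|Pow (Field \<kappa>)| \<le>o |X|"
        using ordIso_transitive[OF \<mu>(2) ordIso_symmetric[OF X(2)]] by (simp add: ordIso_iff_ordLeq)
      show "X \<subseteq> (\<Union>q\<in>Q. e q ` A q)"
      proof
        fix x assume "x \<in> X"
        then obtain j where j: "j \<in> ?J" "x = g j" using \<open>g ` ?J = X\<close> by blast
        then obtain q where "q \<in> Q" "e q j = g j" using Q(3) by blast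
        with j show "x \<in> (\<Union>q\<in>Q. e q ` A q)" by (auto simp: A_def intro!: bexI[of _ q] image_eqI[of _ _ j])
      qed
      have "\<kappa> \<le>o |Field \<kappa>|" using \<kappa> card_of_Field_ordIso ordIso_iff_ordLeq by blast
      with ordLeq_transitive[OF Q(1) \<tau>] show "|Q| \<le>o |Field \<kappa>|" by (rule ordLeq_transitive)
    qed
    then obtain q where q: "q \<in> Q" "|Pow (Field \<kappa>)| \<le>o |e q ` A q|" by (rule bexE)
    have "\<mu> \<le>o |e q ` A q|" using ordIso_symmetric[OF \<mu>(2)] q(2) by (rule ordIso_ordLeq_trans)
    moreover have "|e q ` A q| \<le>o \<mu>" using card_of_mono1[OF sub] X(2) by (rule ordLeq_ordIso_trans)
    ultimately have "|e q ` A q| =o \<mu>" by (simp add: ordIso_iff_ordLeq)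
    moreover have "e q ` A q \<in> (\<lambda>(q, A). e q ` A) ` (?L \<times> Pow ?J)"
      using q(1) Q(2) by (intro image_eqI[of _ _ "(q, A q)"]) (auto simp: A_def)
    moreover have "e q ` A q \<subseteq> ?L" using sub X(1) by (rule subset_trans)
    ultimately have "e q ` A q \<in> D" unfolding D_def mem_Collect_eq by (intro conjI)
    then show "\<exists>Y\<in>D. Y \<subseteq> X" using sub by blast
  qed
  ultimately show ?thesis by blast
qed

text \<open>A set of size \<sigma> contains one of size \<mu> and so a member of \<open>D\<close>.
  Shrinking the members of \<open>D\<close> to size \<nu> keeps them inside.\<close>

lemma dense_family_mono:
  assumes D: "dense_family \<rho> \<mu> \<mu> D" and \<mu>: "Card_order \<mu>" "\<mu> \<le>o \<sigma>" and \<nu>: "Card_order \<nu>" "\<nu> \<le>o \<mu>"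
  shows "\<exists>D'. dense_family \<rho> \<nu> \<sigma> D' \<and> |D'| \<le>o |D|"
proof -
  have "\<forall>Y\<in>D. \<exists>Z. Z \<subseteq> Y \<and> |Z| =o \<nu>"
  proof
    fix Y assume "Y \<in> D"
    then have "|Y| =o \<mu>" using D by (auto simp: dense_family_def subsets_of_card_def)
    then have "\<nu> \<le>o |Y|" using \<nu>(2) ordLeq_ordIso_trans ordIso_symmetric by blast
    then show "\<exists>Z. Z \<subseteq> Y \<and> |Z| =o \<nu>" using subset_of_card[OF \<nu>(1)] by blast
  qed
  then have "\<exists>s. \<forall>Y\<in>D. s Y \<subseteq> Y \<and> |s Y| =o \<nu>" by (rule bchoice)
  then obtain s where s: "\<forall>Y\<in>D. s Y \<subseteq> Y \<and> |s Y| =o \<nu>" by (rule exE)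
  have "dense_family \<rho> \<nu> \<sigma> (s ` D)"
    unfolding dense_family_def dense_in_def
  proof (intro conjI ballI)
    show "s ` D \<subseteq> subsets_of_card (Field \<rho>) \<nu>"
    proof
      fix Z assume "Z \<in> s ` D"
      then obtain Y where Y: "Y \<in> D" "Z = s Y" by blast
      then have "Y \<subseteq> Field \<rho>" using D by (auto simp: dense_family_def subsets_of_card_def)
      with bspec[OF s Y(1)] show "Z \<in> subsets_of_card (Field \<rho>) \<nu>"
        unfolding Y(2) subsets_of_card_def by auto
    qed
    fix X assume "X \<in> subsets_of_card (Field \<rho>) \<sigma>"
    then have X: "X \<subseteq> Field \<rho>" "|X| =o \<sigma>" by (auto simp: subsets_of_card_def)
    then have "\<mu> \<le>o |X|" using \<mu>(2) ordLeq_ordIso_trans ordIso_symmetric by blast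
    then obtain X' where "X' \<subseteq> X" "|X'| =o \<mu>" by (rule subset_of_card[OF \<mu>(1)])
    with X(1) have "X' \<in> subsets_of_card (Field \<rho>) \<mu>" by (auto simp: subsets_of_card_def)
    then have "\<exists>Y\<in>D. Y \<subseteq> X'" using D by (simp add: dense_family_def dense_in_def)
    then obtain Y where Y: "Y \<in> D" "Y \<subseteq> X'" by (rule bexE)
    with bspec[OF s Y(1)] \<open>X' \<subseteq> X\<close> have "s Y \<subseteq> X" by auto
    with Y(1) show "\<exists>Y\<in>s ` D. Y \<subseteq> X" by (intro bexI[of _ "s Y"]) simp_all
  qed
  then show ?thesis using card_of_image by blast
qed

theorem corollary2p8:
  fixes \<nu> :: "'b rel" and \<rho> :: "'a rel"
    and beth :: "nat \<Rightarrow> 'c rel" and beth_\<omega> :: "'d rel"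
  assumes "Cinfinite \<nu>" and "Card_order \<rho>"
    and "beth_seq \<nu> beth" and "card_sup beth beth_\<omega>"
    and "beth_\<omega> \<le>o \<rho>"
  shows "finite {n. \<not> density_same \<rho> (beth n) =o \<rho>} \<and> density \<rho> \<nu> beth_\<omega> =o \<rho>"
proof -
  have b0: "beth 0 =o \<nu>" and co: "\<And>n. Card_order (beth n)"
    using assms(3) by (auto simp: beth_seq_def)
  have pow: "|Pow (Field (beth n))| =o beth (Suc n)" for n
  proof -
    have "beth (Suc n) =o |Func (Field (beth n)) (UNIV :: bool set)|"
      using assms(3) by (simp add: beth_seq_def cexp_def ctwo_def Field_card_of)
    then show ?thesis by (rule ordIso_transitive[OF card_of_Pow_Func ordIso_symmetric])
  qed
  have inf: "Cinfinite (beth n)" for n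
  proof (induction n)
    case 0
    show ?case by (rule Cinfinite_cong[OF ordIso_symmetric[OF b0] assms(1)])
  next
    case (Suc n)
    then have "Cinfinite |Pow (Field (beth n))|" by (intro Cinfinite_card_of) (simp add: cinfinite_def)
    then show ?case by (rule Cinfinite_cong[OF pow])
  qed
  note less = beth_less_Suc[where b = beth, OF inf pow] and mono = beth_mono[where b = beth, OF inf pow]
  have \<omega>: "beth n \<le>o beth_\<omega>" and co\<omega>: "Card_order beth_\<omega>" for n
    using assms(4) by (auto simp: card_sup_def)
  have le: "beth n \<le>o \<rho>" for n using \<omega> assms(5) by (rule ordLeq_transitive)
  \<comment> \<open>The next beth number is still at most \<rho>; the lower bound on the density
    uses this strictness.\<close>
  have lt: "beth n <o \<rho>" for n using less le by (rule ordLess_ordLeq_trans)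
  have \<rho>: "Cinfinite \<rho>" using cinfinite_mono[OF le[of 0]] inf assms(2) by blast
  obtain n where n: "\<And>k. covered (Field \<rho>) (Field (beth k)) (beth n)"
    using covered_beth[where b = beth and L = "Field \<rho>", OF inf pow] by blast
  \<comment> \<open>Koenig's theorem is applied to \<open>beth (Suc m)\<close> as the power of
    \<open>beth m\<close>, hence the successor index; exceptions can occur only up to
    \<open>n\<close>.\<close>
  have dense: "\<exists>D. dense_family \<rho> (beth (Suc m)) (beth (Suc m)) D \<and> |D| \<le>o \<rho>" if "n \<le> m" for m
    using \<rho> inf[of m] co[of "Suc m"] pow[of m] mono[OF that] ordIso_ordLeq_trans[OF pow le] n
    by (rule covered_dense_family)
  have "density_same \<rho> (beth m) =o \<rho>" if m: "n < m" for m
  proof -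
    from m obtain m' where m': "m = Suc m'" "n \<le> m'" by (cases m) auto
    from dense[OF m'(2)] obtain D where "dense_family \<rho> (beth m) (beth m) D" "|D| \<le>o \<rho>"
      unfolding m'(1) by blast
    then show ?thesis by (rule density_eqI[OF \<rho> inf lt co ordLeq_refl[OF co] le])
  qed
  then have "{m. \<not> density_same \<rho> (beth m) =o \<rho>} \<subseteq> {..n}" by (auto simp: not_less[symmetric])
  then have "finite {m. \<not> density_same \<rho> (beth m) =o \<rho>}" by (rule finite_subset) simp
  moreover have "density \<rho> \<nu> beth_\<omega> =o \<rho>"
  proof -
    have co\<nu>: "Card_order \<nu>" using assms(1) by blast
    \<comment> \<open>\<open>beth (Suc n)\<close> lies between \<nu> and
      \<open>beth_\<omega>\<close>, so its dense family can be adapted to both.\<close>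
    obtain D where D: "dense_family \<rho> (beth (Suc n)) (beth (Suc n)) D" "|D| \<le>o \<rho>" using dense by blast
    have "\<nu> \<le>o beth (Suc n)" using ordIso_symmetric[OF b0] mono[of 0 "Suc n"] by (blast intro: ordIso_ordLeq_trans)
    with D(1) co \<omega> co\<nu> obtain D' where D': "dense_family \<rho> \<nu> beth_\<omega> D'" "|D'| \<le>o |D|"
      using dense_family_mono by blast
    have "\<nu> <o \<rho>" "\<nu> \<le>o beth_\<omega>"
      using ordIso_symmetric[OF b0] lt[of 0] \<omega>[of 0] ordIso_ordLess_trans ordIso_ordLeq_trans by blast+
    then show ?thesis
      using density_eqI[OF \<rho> assms(1) _ co\<omega> _ assms(5) D'(1)] ordLeq_transitive[OF D'(2) D(2)] by blast
  qed
  ultimately show ?thesis by blast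
qed

end
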